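(* Let $\mathcal{F}_1,\mathcal{F}_2$ be any two nonempty families of graphs and let $k\ge 1$ be an integer. Then $$\mathrm{Rs}(\mathcal{F}_1,\mathcal{F}_2,k)\ \le\ k\,\bigl(\mathrm{R}(\mathcal{F}_1,\mathcal{F}_2)-1\bigr)^2+1 .$$
   Context: All graphs are finite and simple. For an integer $k\ge1$, a finite multiset of integers, listed as $a_1\le a_2\le\dots\le a_n$, is $k$-singular if either $a_1=\dots=a_n$ or $a_{j+1}-a_j\ge k$ for every $j=1,\dots,n-1$. A (not necessarily induced) subgraph $H$ of a host graph $G$ is $k$-singular if the multiset of degrees $d_G(v)$, $v\in V(H)$, taken in $G$, is $k$-singular. In an edge 2-coloring of $K_m$ the host graph of color $i$ is the spanning graph $G_i$ on all $m$ vertices whose edges are the edges of color $i$. $\mathrm{Rs}(\mathcal{F}_1,\mathcal{F}_2,k)$ is the smallest integer $n$ such that for every $m\ge n$ and every 2-coloring of the edges of $K_m$, there is $i\in\{1,2\}$ such that $G_i$ contains a $k$-singular subgraph isomorphic to a member of $\mathcal{F}_i$. $\mathrm{R}(\mathcal{F}_1,\mathcal{F}_2)$ is the ordinary Ramsey number: the smallest $n$ such that in every 2-coloring of the edges of $K_n$, color 1 contains a member of $\mathcal{F}_1$ or color 2 contains a member of $\mathcal{F}_2$. *)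

theory Defs
  imports Main "HOL-Library.Multiset" "HOL-Library.FuncSet" "HOL-Library.Ramsey"
begin

type_synonym 'a ugraph = "'a set \<times> 'a set set"

abbreviation verts :: "'a ugraph \<Rightarrow> 'a set" where
  "verts G \<equiv> fst G"

abbreviation edges :: "'a ugraph \<Rightarrow> 'a set set" where
  "edges G \<equiv> snd G"

text \<open>Here \<open>nsets V 2\<close> is the set of two-element subsets of \<open>V\<close>. The graph without
  vertices is not excluded.\<close>

definition simple_graph :: "'a ugraph \<Rightarrow> bool" where
  "simple_graph G \<longleftrightarrow> finite (verts G) \<and> edges G \<subseteq> nsets (verts G) 2"

definition degree :: "'a ugraph \<Rightarrow> 'a \<Rightarrow> nat" where
  "degree G v = card {e \<in> edges G. v \<in> e}"

definition subgraph :: "'a ugraph \<Rightarrow> 'a ugraph \<Rightarrow> bool" where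
  "subgraph H G \<longleftrightarrow> simple_graph H \<and> simple_graph G \<and> verts H \<subseteq> verts G \<and> edges H \<subseteq> edges G"

definition graph_iso :: "'a ugraph \<Rightarrow> 'b ugraph \<Rightarrow> bool" where
  "graph_iso G H \<longleftrightarrow> (\<exists>f. bij_betw f (verts G) (verts H) \<and>
     (\<forall>u\<in>verts G. \<forall>v\<in>verts G. {u, v} \<in> edges G \<longleftrightarrow> {f u, f v} \<in> edges H))"

definition singular_mset :: "nat \<Rightarrow> int multiset \<Rightarrow> bool" where
  "singular_mset k M \<longleftrightarrow> (let a = sorted_list_of_multiset M in
     (\<forall>i<length a. \<forall>j<length a. a ! i = a ! j) \<or>
     (\<forall>j. Suc j < length a \<longrightarrow> a ! Suc j - a ! j \<ge> int k))"

text \<open>The degrees are those in the host graph \<open>G\<close>, not in \<open>H\<close>.\<close>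

definition singular_subgraph :: "nat \<Rightarrow> 'a ugraph \<Rightarrow> 'a ugraph \<Rightarrow> bool" where
  "singular_subgraph k H G \<longleftrightarrow> subgraph H G \<and>
     singular_mset k (image_mset (\<lambda>v. int (degree G v)) (mset_set (verts H)))"

definition contains_member :: "'a ugraph \<Rightarrow> 'b ugraph set \<Rightarrow> bool" where
  "contains_member G \<F> \<longleftrightarrow> (\<exists>H. subgraph H G \<and> (\<exists>F\<in>\<F>. graph_iso H F))"

definition contains_singular_member :: "nat \<Rightarrow> 'a ugraph \<Rightarrow> 'b ugraph set \<Rightarrow> bool" where
  "contains_singular_member k G \<F> \<longleftrightarrow>
     (\<exists>H. singular_subgraph k H G \<and> (\<exists>F\<in>\<F>. graph_iso H F))"

text \<open>The complete graph on \<open>m\<close> vertices is taken on the vertex set \<open>{..<m}\<close>.\<close>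

definition two_coloring :: "nat \<Rightarrow> (nat set \<Rightarrow> nat) \<Rightarrow> bool" where
  "two_coloring m c \<longleftrightarrow> c \<in> nsets {..<m} 2 \<rightarrow> {1, 2}"

definition color_graph :: "nat \<Rightarrow> (nat set \<Rightarrow> nat) \<Rightarrow> nat \<Rightarrow> nat ugraph" where
  "color_graph m c i = ({..<m}, {e \<in> nsets {..<m} 2. c e = i})"

definition ramsey_property :: "'a ugraph set \<Rightarrow> 'b ugraph set \<Rightarrow> nat \<Rightarrow> bool" where
  "ramsey_property \<F>1 \<F>2 n \<longleftrightarrow> (\<forall>c. two_coloring n c \<longrightarrow>
     contains_member (color_graph n c 1) \<F>1 \<or> contains_member (color_graph n c 2) \<F>2)"

text \<open>The two numbers below are genuine minima only if the respective property holds for some \<open>n\<close>.\<close>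

definition ramsey_number :: "'a ugraph set \<Rightarrow> 'b ugraph set \<Rightarrow> nat" where
  "ramsey_number \<F>1 \<F>2 = (LEAST n. ramsey_property \<F>1 \<F>2 n)"

definition singular_ramsey_property :: "'a ugraph set \<Rightarrow> 'b ugraph set \<Rightarrow> nat \<Rightarrow> nat \<Rightarrow> bool" where
  "singular_ramsey_property \<F>1 \<F>2 k n \<longleftrightarrow> (\<forall>m\<ge>n. \<forall>c. two_coloring m c \<longrightarrow>
     contains_singular_member k (color_graph m c 1) \<F>1 \<or>
     contains_singular_member k (color_graph m c 2) \<F>2)"

definition singular_ramsey_number :: "'a ugraph set \<Rightarrow> 'b ugraph set \<Rightarrow> nat \<Rightarrow> nat" where
  "singular_ramsey_number \<F>1 \<F>2 k = (LEAST n. singular_ramsey_property \<F>1 \<F>2 k n)"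

end

theory Submission imports Defs begin

text \<open>
  Write \<open>R\<close> for the Ramsey number. In a coloring of \<open>K\<^sub>m\<close> the two degrees of a vertex add up to
  \<open>m - 1\<close>, so the degree sequence of one color is a reflection of that of the other. Reflection
  preserves the distances between degrees, hence a vertex set is \<open>k\<close>-singular for one color
  exactly if it is for the other. Moreover every subset of a \<open>k\<close>-singular set is \<open>k\<close>-singular.

  It therefore suffices to find \<open>R\<close> vertices whose degrees in color 1 are \<open>k\<close>-singular: by the
  definition of \<open>R\<close>, the coloring restricted to them contains the required monochromatic graph,
  and any subgraph on these vertices is \<open>k\<close>-singular, whichever color it has. Such vertices come
  from two uses of the pigeonhole principle (\<open>singular_subset_exists\<close>). Among more than
  \<open>k (R - 1)\<^sup>2\<close> vertices either \<open>R\<close> share a degree, or more than \<open>k (R - 1)\<close> degrees occur. In the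
  second case \<open>R\<close> of these degrees agree modulo \<open>k\<close>, so that they are pairwise at least \<open>k\<close> apart.
\<close>

section \<open>Singular sets of values\<close>

text \<open>Stating the condition by pairwise distances, without sorting, makes its inheritance by subsets
  and its invariance under reflection evident.\<close>

definition singular_on :: "nat \<Rightarrow> ('a \<Rightarrow> int) \<Rightarrow> 'a set \<Rightarrow> bool" where
  "singular_on k d S \<longleftrightarrow> (\<forall>x\<in>S. \<forall>y\<in>S. d x = d y) \<or>
     (\<forall>x\<in>S. \<forall>y\<in>S. x \<noteq> y \<longrightarrow> int k \<le> \<bar>d x - d y\<bar>)"

lemma singular_on_subset: "singular_on k d S \<Longrightarrow> T \<subseteq> S \<Longrightarrow> singular_on k d T"
  unfolding singular_on_def by blast

lemma singular_on_reflect: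
  assumes "singular_on k d S" and "\<And>x. x \<in> S \<Longrightarrow> d x + e x = c"
  shows "singular_on k e S"
proof -
  have e: "e x = c - d x" if "x \<in> S" for x
    using assms(2)[OF that] by simp
  show ?thesis
    using assms(1) unfolding singular_on_def by (simp add: e abs_minus_commute cong: ball_cong)
qed

text \<open>If the values are pairwise at least \<open>k \<ge> 1\<close> apart, then the multiset is a set, and its sorted
  list is strictly increasing, so that the pairwise distances bound the gaps.\<close>

lemma singular_mset_if_singular_on:
  assumes fin: "finite S" and k: "k \<ge> 1" and sing: "singular_on k d S"
  shows "singular_mset k (image_mset d (mset_set S))"
proof -
  define a where "a = sorted_list_of_multiset (image_mset d (mset_set S))"
  have mset_a: "mset a = image_mset d (mset_set S)"
    by (simp add: a_def)
  have set_a: "set a = d ` S"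
    using arg_cong[OF mset_a, of set_mset] fin by simp
  consider (const) "\<forall>x\<in>S. \<forall>y\<in>S. d x = d y"
    | (apart) "\<forall>x\<in>S. \<forall>y\<in>S. x \<noteq> y \<longrightarrow> int k \<le> \<bar>d x - d y\<bar>"
    using sing unfolding singular_on_def by blast
  then have "(\<forall>i<length a. \<forall>j<length a. a ! i = a ! j) \<or>
     (\<forall>j. Suc j < length a \<longrightarrow> a ! Suc j - a ! j \<ge> int k)"
  proof cases
    case const
    have "a ! i = a ! j" if "i < length a" "j < length a" for i j
    proof -
      have "a ! i \<in> d ` S" "a ! j \<in> d ` S"
        using that set_a nth_mem by metis+
      then show ?thesis
        using const by (metis imageE)
    qed
    then show ?thesis by blast
  next
    case apart
    have "inj_on d S"
      using apart k by (force simp: inj_on_def)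
    then have a: "a = sorted_list_of_set (d ` S)"
      by (simp add: a_def image_mset_mset_set)
    have "a ! Suc j - a ! j \<ge> int k" if j: "Suc j < length a" for j
    proof -
      have less: "a ! j < a ! Suc j"
        using j sorted_wrt_nth_less[OF strict_sorted_list_of_set[of "d ` S"], of j "Suc j"]
        by (simp add: a)
      have "a ! j \<in> d ` S" "a ! Suc j \<in> d ` S"
        using j nth_mem[of j a] nth_mem[of "Suc j" a] by (auto simp: set_a)
      then obtain x y where xy: "x \<in> S" "y \<in> S" "a ! j = d x" "a ! Suc j = d y"
        by blast
      with less have "x \<noteq> y" by auto
      with apart xy have "int k \<le> \<bar>d x - d y\<bar>" by blast
      with less show ?thesis unfolding xy(3,4) by linarith
    qed
    then show ?thesis by blast
  qed
  then show ?thesis by (simp add: singular_mset_def Let_def a_def)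
qed

lemma large_fibre_exists:
  assumes "finite A" "finite B" "f ` A \<subseteq> B" "r * card B < card A"
  shows "\<exists>y\<in>B. r < card {x \<in> A. f x = y}"
proof (rule ccontr)
  assume "\<not> ?thesis"
  then have "card {x \<in> A. f x = y} \<le> r" if "y \<in> B" for y
    using that by (auto simp: not_less)
  then have "(\<Sum>y\<in>B. card {x \<in> A. f x = y}) \<le> r * card B"
    using sum_bounded_above[of B "\<lambda>y. card {x \<in> A. f x = y}" r] by (simp add: mult.commute)
  moreover have "(\<Sum>y\<in>B. card {x \<in> A. f x = y}) = card A"
    using sum.group[OF assms(1-3), of "\<lambda>_. 1::nat"] by simp
  ultimately show False using assms(4) by simp
qed

text \<open>If no value is taken more than \<open>r\<close> times, more than \<open>k r\<close> values occur, and more than \<open>r\<close> of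
  them lie in one residue class modulo \<open>k\<close>. Distinct integers in one class are at least \<open>k\<close>
  apart.\<close>

lemma singular_subset_exists:
  fixes d :: "'a \<Rightarrow> int"
  assumes fin: "finite V" and card: "k * r\<^sup>2 < card V" and k: "k \<ge> 1"
  shows "\<exists>S\<subseteq>V. card S = Suc r \<and> singular_on k d S"
proof -
  have "\<exists>T\<subseteq>V. r < card T \<and> singular_on k d T"
  proof (cases "\<exists>y\<in>d ` V. r < card {x \<in> V. d x = y}")
    case True
    then obtain y where "r < card {x \<in> V. d x = y}" by blast
    then show ?thesis
      by (intro exI[of _ "{x \<in> V. d x = y}"]) (auto simp: singular_on_def)
  next
    case False
    then have "card V \<le> r * card (d ` V)"
      using large_fibre_exists[of V "d ` V" d r] fin by (meson finite_imageI not_less order_refl)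
    moreover have "r * (r * k) = k * r\<^sup>2"
      by algebra
    ultimately have "r * (r * k) < r * card (d ` V)"
      using card by linarith
    then have "r * card {0..<int k} < card (d ` V)"
      by simp
    moreover have "(\<lambda>y. y mod int k) ` d ` V \<subseteq> {0..<int k}"
      using k by auto
    ultimately obtain c where c: "r < card {y \<in> d ` V. y mod int k = c}"
      using large_fibre_exists[of "d ` V" "{0..<int k}" "\<lambda>y. y mod int k" r] fin
      by (meson finite_atLeastLessThan_int finite_imageI)
    define D where "D = {y \<in> d ` V. y mod int k = c}"
    \<comment> \<open>\<open>T\<close> has one representative for each value in the residue class.\<close>
    obtain T where T: "T \<subseteq> V" "inj_on d T" "d ` T = D"
      using subset_image_inj[of D d V] by (auto simp: D_def)
    have "int k \<le> \<bar>d x - d y\<bar>" if "x \<in> T" "y \<in> T" "x \<noteq> y" for x y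
    proof -
      have "d x \<noteq> d y" using T(2) that by (auto simp: inj_on_def)
      moreover have "d x \<in> D" "d y \<in> D"
        using T(3) that by blast+
      then have "d x mod int k = d y mod int k"
        by (simp add: D_def)
      then have "int k dvd d x - d y"
        by (simp add: mod_eq_dvd_iff)
      ultimately show ?thesis
        by (intro zdvd_imp_le) auto
    qed
    moreover have "card T = card D"
      using card_image[OF T(2)] T(3) by simp
    ultimately show ?thesis
      using T(1) c by (intro exI[of _ T]) (simp add: singular_on_def D_def)
  qed
  then obtain T where T: "T \<subseteq> V" "Suc r \<le> card T" "singular_on k d T"
    by (auto simp: Suc_le_eq)
  then obtain S where "S \<subseteq> T" "card S = Suc r"
    by (meson obtain_subset_with_card_n)
  with T show ?thesis
    using singular_on_subset by blast
qed

section \<open>Injective images of graphs\<close>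

definition map_graph :: "('a \<Rightarrow> 'b) \<Rightarrow> 'a ugraph \<Rightarrow> 'b ugraph" where
  "map_graph f G = (f ` verts G, (`) f ` edges G)"

lemma edge_image_in_nsets_2:
  assumes "e \<in> nsets A 2" "inj_on f A"
  shows "f ` e \<in> nsets (f ` A) 2"
  using assms by (auto elim!: nsets2_E simp: inj_on_def)

lemma simple_graph_map_graph:
  assumes "simple_graph G" "inj_on f (verts G)"
  shows "simple_graph (map_graph f G)"
  using assms edge_image_in_nsets_2 by (fastforce simp: simple_graph_def map_graph_def)

lemma graph_iso_map_graph:
  assumes simple: "simple_graph H" and inj: "inj_on f (verts H)" and iso: "graph_iso H F"
  shows "graph_iso (map_graph f H) F"
proof -
  obtain g where g: "bij_betw g (verts H) (verts F)"
    and edge: "\<And>u v. \<lbrakk>u \<in> verts H; v \<in> verts H\<rbrakk> \<Longrightarrow> {u, v} \<in> edges H \<longleftrightarrow> {g u, g v} \<in> edges F"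
    using iso unfolding graph_iso_def by blast
  define f' where "f' = inv_into (verts H) f"
  have f': "f' (f u) = u" if "u \<in> verts H" for u
    using inj that by (simp add: f'_def)
  have bij: "bij_betw (g \<circ> f') (f ` verts H) (verts F)"
    using bij_betw_trans[OF bij_betw_inv_into[OF inj_on_imp_bij_betw[OF inj]] g]
    by (simp add: f'_def)
  have "{f u, f v} \<in> (`) f ` edges H \<longleftrightarrow> {u, v} \<in> edges H"
    if uv: "u \<in> verts H" "v \<in> verts H" for u v
  proof
    assume "{f u, f v} \<in> (`) f ` edges H"
    then obtain e where e: "e \<in> edges H" "f ` e = f ` {u, v}" by auto
    moreover have "e \<subseteq> verts H"
      using e simple by (auto simp: simple_graph_def nsets_def)
    ultimately have "e = {u, v}"
      using inj_on_image_eq_iff[OF inj, of e "{u, v}"] uv by simp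
    with e show "{u, v} \<in> edges H" by simp
  next
    assume "{u, v} \<in> edges H"
    then have "f ` {u, v} \<in> (`) f ` edges H" by (rule imageI)
    then show "{f u, f v} \<in> (`) f ` edges H" by simp
  qed
  with bij show ?thesis
    unfolding graph_iso_def map_graph_def
    by (intro exI[of _ "g \<circ> f'"]) (simp add: f' edge)
qed

lemma graph_iso_refl: "graph_iso G G"
  unfolding graph_iso_def by (intro exI[of _ id]) simp

section \<open>The two color graphs\<close>

lemma verts_color_graph [simp]: "verts (color_graph m c i) = {..<m}"
  by (simp add: color_graph_def)

lemma edges_color_graph [simp]: "edges (color_graph m c i) = {e \<in> nsets {..<m} 2. c e = i}"
  by (simp add: color_graph_def)

lemma simple_color_graph: "simple_graph (color_graph m c i)"
  by (auto simp: simple_graph_def)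

lemma degree_color_graph_sum:
  assumes c: "two_coloring m c" and v: "v < m"
  shows "degree (color_graph m c 1) v + degree (color_graph m c 2) v = m - 1"
proof -
  let ?E = "\<lambda>i. {e \<in> edges (color_graph m c i). v \<in> e}"
  let ?star = "{e \<in> nsets {..<m} 2. v \<in> e}"
  have star: "?star = (\<lambda>u. {u, v}) ` ({..<m} - {v})"
    using v by (auto simp: nsets_2_eq)
  have "inj_on (\<lambda>u. {u, v}) ({..<m} - {v})"
    by (auto simp: inj_on_def doubleton_eq_iff)
  then have card_star: "card ?star = m - 1"
    using v by (simp add: star card_image)
  have un: "?star = ?E 1 \<union> ?E 2"
    using c by (auto simp: two_coloring_def)
  have "finite ?star"
    by (simp add: star)
  then have "finite (?E 1)" "finite (?E 2)"
    unfolding un by simp_all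
  then have "card ?star = card (?E 1) + card (?E 2)"
    unfolding un by (rule card_Un_disjoint) auto
  with card_star show ?thesis
    unfolding degree_def by simp
qed

text \<open>An injection that preserves colors carries monochromatic subgraphs to monochromatic
  subgraphs. If its range is \<open>k\<close>-singular, so is every subgraph obtained this way.\<close>

lemma contains_singular_member_if_pullback:
  assumes member: "contains_member (color_graph n (\<lambda>e. c (f ` e)) i) \<F>"
    and f: "inj_on f {..<n}" "f ` {..<n} \<subseteq> {..<m}"
    and k: "k \<ge> 1"
    and sing: "singular_on k (\<lambda>v. int (degree (color_graph m c i) v)) (f ` {..<n})"
  shows "contains_singular_member k (color_graph m c i) \<F>"
proof -
  obtain H F where H: "subgraph H (color_graph n (\<lambda>e. c (f ` e)) i)"
    and F: "F \<in> \<F>" "graph_iso H F"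
    using member unfolding contains_member_def by blast
  have simple: "simple_graph H" and verts: "verts H \<subseteq> {..<n}"
    and edges: "edges H \<subseteq> {e \<in> nsets {..<n} 2. c (f ` e) = i}"
    using H by (auto simp: subgraph_def)
  have inj: "inj_on f (verts H)"
    using f(1) verts by (rule inj_on_subset)
  have edge: "f ` e \<in> nsets {..<m} 2" if "e \<in> edges H" for e
    using edge_image_in_nsets_2[OF _ f(1), of e] nsets_mono[OF f(2)] edges that by blast
  have "f ` verts H \<subseteq> {..<m}"
    using verts f(2) by blast
  then have "subgraph (map_graph f H) (color_graph m c i)"
    using simple_graph_map_graph[OF simple inj] simple_color_graph edges edge
    by (auto simp: subgraph_def map_graph_def)
  moreover have "singular_mset k (image_mset (\<lambda>v. int (degree (color_graph m c i) v))
      (mset_set (verts (map_graph f H))))"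
  proof (rule singular_mset_if_singular_on[OF _ k])
    show "finite (verts (map_graph f H))"
      using simple by (simp add: simple_graph_def map_graph_def)
    show "singular_on k (\<lambda>v. int (degree (color_graph m c i) v)) (verts (map_graph f H))"
      using singular_on_subset[OF sing] verts by (simp add: map_graph_def image_mono)
  qed
  ultimately show ?thesis
    using F graph_iso_map_graph[OF simple inj]
    unfolding contains_singular_member_def singular_subgraph_def by blast
qed

section \<open>Ramsey numbers\<close>

lemma contains_member_if_complete:
  assumes F: "F \<in> \<F>" "simple_graph F" and G: "simple_graph G"
    and S: "finite S" "S \<subseteq> verts G" "card S = card (verts F)" "nsets S 2 \<subseteq> edges G"
  shows "contains_member G \<F>"
proof -
  have "finite (verts F)" using F(2) by (simp add: simple_graph_def)
  then obtain f where f: "bij_betw f (verts F) S"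
    using S by (metis finite_same_card_bij)
  then have inj: "inj_on f (verts F)" and im: "f ` verts F = S"
    by (auto simp: bij_betw_def)
  have "(`) f ` edges F \<subseteq> nsets S 2"
    using edge_image_in_nsets_2[OF _ inj] F(2) im by (auto simp: simple_graph_def)
  then have "subgraph (map_graph f F) G"
    using simple_graph_map_graph[OF F(2) inj] G S im by (auto simp: subgraph_def map_graph_def)
  then show ?thesis
    using F(1) graph_iso_map_graph[OF F(2) inj graph_iso_refl]
    unfolding contains_member_def by blast
qed

text \<open>Ramsey's theorem yields a monochromatic complete graph on as many vertices as some fixed
  member of the family of that color, and this complete graph contains the member.\<close>

lemma ramsey_property_exists:
  assumes F1: "F1 \<in> \<F>1" "simple_graph F1" and F2: "F2 \<in> \<F>2" "simple_graph F2"
  shows "\<exists>n. ramsey_property \<F>1 \<F>2 n"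
proof -
  obtain n where n: "\<forall>(V::nat set) E. finite V \<and> card V \<ge> n \<longrightarrow>
      (\<exists>S\<subseteq>V. card S = card (verts F1) \<and> clique S E \<or> card S = card (verts F2) \<and> indep S E)"
    using ramsey2 by blast
  have "contains_member (color_graph n c 1) \<F>1 \<or> contains_member (color_graph n c 2) \<F>2"
    if c: "two_coloring n c" for c
  proof -
    let ?E = "edges (color_graph n c 1)"
    obtain S where S: "S \<subseteq> {..<n}"
      and "card S = card (verts F1) \<and> clique S ?E \<or> card S = card (verts F2) \<and> indep S ?E"
      using n[rule_format, of "{..<n}" ?E] by auto
    moreover have fin: "finite S" using S finite_subset by blast
    moreover have "nsets S 2 \<subseteq> ?E" if "clique S ?E"
      using that by (auto simp: clique_def elim!: nsets2_E)
    moreover have "nsets S 2 \<subseteq> edges (color_graph n c 2)" if "indep S ?E"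
    proof
      fix e assume e: "e \<in> nsets S 2"
      then have "e \<notin> ?E"
        using that unfolding indep_def by (metis nsets2_E)
      then show "e \<in> edges (color_graph n c 2)"
        using e c nsets_mono[OF S] by (auto simp: two_coloring_def)
    qed
    ultimately show ?thesis
      using contains_member_if_complete[OF F1 simple_color_graph fin, of n c 1]
        contains_member_if_complete[OF F2 simple_color_graph fin, of n c 2]
      by auto
  qed
  then show ?thesis unfolding ramsey_property_def by blast
qed

lemma singular_ramsey_property_if_ramsey_property:
  assumes ramsey: "ramsey_property \<F>1 \<F>2 n" and k: "k \<ge> 1"
  shows "singular_ramsey_property \<F>1 \<F>2 k (k * (n - 1)\<^sup>2 + 1)"
  unfolding singular_ramsey_property_def
proof (intro allI impI)
  fix m c
  assume m: "k * (n - 1)\<^sup>2 + 1 \<le> m" and c: "two_coloring m c"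
  define d where "d i v = int (degree (color_graph m c i) v)" for i v
  have "\<exists>S\<subseteq>{..<m}. card S = n \<and> singular_on k (d 1) S"
  proof (cases n)
    case 0
    then show ?thesis by (intro exI[of _ "{}"]) (simp add: singular_on_def)
  next
    case (Suc r)
    then show ?thesis
      using singular_subset_exists[of "{..<m}" k r "d 1"] m k by simp
  qed
  then obtain S where S: "S \<subseteq> {..<m}" "card S = n" and sing1: "singular_on k (d 1) S"
    by blast
  have sing2: "singular_on k (d 2) S"
  proof (rule singular_on_reflect[OF sing1])
    fix v assume "v \<in> S"
    then show "d 1 v + d 2 v = int (m - 1)"
      using degree_color_graph_sum[OF c, of v] S(1) unfolding d_def by (auto simp flip: of_nat_add)
  qed
  obtain f where "bij_betw f {..<n} S"
    using S finite_subset[OF S(1)] by (metis card_lessThan finite_lessThan finite_same_card_bij)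
  then have f: "inj_on f {..<n}" "f ` {..<n} = S"
    by (auto simp: bij_betw_def)
  have "f ` e \<in> nsets {..<m} 2" if "e \<in> nsets {..<n} 2" for e
    using edge_image_in_nsets_2[OF that f(1)] nsets_mono[OF S(1)] f(2) by auto
  then have "two_coloring n (\<lambda>e. c (f ` e))"
    using c by (auto simp: two_coloring_def Pi_iff)
  then have "contains_member (color_graph n (\<lambda>e. c (f ` e)) 1) \<F>1 \<or>
      contains_member (color_graph n (\<lambda>e. c (f ` e)) 2) \<F>2"
    using ramsey by (simp add: ramsey_property_def)
  then show "contains_singular_member k (color_graph m c 1) \<F>1 \<or>
      contains_singular_member k (color_graph m c 2) \<F>2"
    using contains_singular_member_if_pullback[of n c f 1 \<F>1 m k]
      contains_singular_member_if_pullback[of n c f 2 \<F>2 m k] f S(1) k sing1 sing2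
    unfolding d_def by metis
qed

theorem theorem11:
  fixes \<F>1 :: "'a ugraph set" and \<F>2 :: "'b ugraph set" and k :: nat
  assumes "\<forall>F\<in>\<F>1. simple_graph F" and "\<forall>F\<in>\<F>2. simple_graph F"
    and "\<F>1 \<noteq> {}" and "\<F>2 \<noteq> {}"
    and "k \<ge> 1"
  shows "(\<exists>n. ramsey_property \<F>1 \<F>2 n) \<and> (\<exists>n. singular_ramsey_property \<F>1 \<F>2 k n) \<and>
    int (singular_ramsey_number \<F>1 \<F>2 k) \<le> int k * (int (ramsey_number \<F>1 \<F>2) - 1)\<^sup>2 + 1"
proof -
  define R where "R = ramsey_number \<F>1 \<F>2"
  have ex: "\<exists>n. ramsey_property \<F>1 \<F>2 n"
    using assms ramsey_property_exists by blast
  then have "ramsey_property \<F>1 \<F>2 R"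
    unfolding R_def ramsey_number_def by (rule LeastI_ex)
  then have sing: "singular_ramsey_property \<F>1 \<F>2 k (k * (R - 1)\<^sup>2 + 1)"
    using assms(5) by (rule singular_ramsey_property_if_ramsey_property)
  then have "singular_ramsey_number \<F>1 \<F>2 k \<le> k * (R - 1)\<^sup>2 + 1"
    unfolding singular_ramsey_number_def by (rule Least_le)
  then have "int (singular_ramsey_number \<F>1 \<F>2 k) \<le> int (k * (R - 1)\<^sup>2 + 1)"
    by (simp only: of_nat_le_iff)
  \<comment> \<open>\<open>R = 0\<close> if a family contains the graph without vertices; then \<open>(int R - 1)\<^sup>2 = 1\<close>, while
    the natural number \<open>R - 1\<close> is \<open>0\<close>.\<close>
  also have "\<dots> \<le> int k * (int R - 1)\<^sup>2 + 1"
    by (cases R) auto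
  finally show ?thesis
    using ex sing unfolding R_def by blast
qed

end
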